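(* Let $T,S,X\in\mathbb{B}_A(\mathcal{H})$ and let $N_A$ be a seminorm on $\mathbb{B}_{A^{1/2}}(\mathcal{H})$ which is $A$-selfadjoint invariant and submultiplicative. Then (for each choice of sign) $$\omega_{N_A}\big(TXS\pm S^{\sharp_A}XT^{\sharp_A}\big)\le 2N_A(T)N_A(S)\,\omega_{N_A}(X).$$
   Context: $\mathcal{H}$ is a complex Hilbert space with inner product $\langle\cdot,\cdot\rangle$, $\mathbb{B}(\mathcal{H})$ is the algebra of bounded linear operators on $\mathcal{H}$, and $A\in\mathbb{B}(\mathcal{H})$ is a non-zero positive operator ($\langle Ax,x\rangle\ge 0$ for all $x$). Put $\|x\|_A=\sqrt{\langle Ax,x\rangle}$. $\mathbb{B}_A(\mathcal{H})$ is the set of $T\in\mathbb{B}(\mathcal{H})$ with $\mathcal{R}(T^*A)\subseteq\mathcal{R}(A)$ ($\mathcal{R}$ denotes range). $\mathbb{B}_{A^{1/2}}(\mathcal{H})$ is the set of $T\in\mathbb{B}(\mathcal{H})$ for which there is $c>0$ with $\|Tx\|_A\le c\|x\|_A$ for all $x\in\mathcal{H}$. Both are subalgebras of $\mathbb{B}(\mathcal{H})$ and $\mathbb{B}_A(\mathcal{H})\subseteq\mathbb{B}_{A^{1/2}}(\mathcal{H})$. For $T\in\mathbb{B}_A(\mathcal{H})$, $T^{\sharp_A}$ is the unique $Y\in\mathbb{B}(\mathcal{H})$ with $AY=T^*A$ and $\mathcal{R}(Y)\subseteq\overline{\mathcal{R}(A)}$; one has $T^{\sharp_A}\in\mathbb{B}_A(\mathcal{H})$.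 Put $\Re_A(T)=\frac{T+T^{\sharp_A}}{2}$. For a seminorm $N_A$, $\omega_{N_A}(T)=\sup_{\theta\in\mathbb{R}}N_A\big(\Re_A(e^{i\theta}T)\big)$ for $T\in\mathbb{B}_A(\mathcal{H})$. $N_A$ is $A$-selfadjoint invariant if $N_A(T)=N_A(T^{\sharp_A})$ for all $T\in\mathbb{B}_A(\mathcal{H})$, and submultiplicative if $N_A(TS)\le N_A(T)N_A(S)$ for all $T,S\in\mathbb{B}_{A^{1/2}}(\mathcal{H})$. *)

theory Defs
  imports "HOL-Analysis.Analysis"
begin

text \<open>
  Complex Hilbert spaces, with the inner product linear in its first argument.  The underlying
  real Hilbert space is the library's, with real inner product \<open>Re \<langle>x, y\<rangle>\<close>; hence
  \<open>norm x = sqrt (Re \<langle>x, x\<rangle>)\<close>, and positive definiteness is inherited from \<^class>\<open>real_inner\<close>.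
\<close>

class chilbert_space = real_inner + banach +
  fixes scaleC :: "complex \<Rightarrow> 'a \<Rightarrow> 'a" (infixr "*\<^sub>C" 75)
    and cinner :: "'a \<Rightarrow> 'a \<Rightarrow> complex"
  assumes scaleC_add_right: "c *\<^sub>C (x + y) = c *\<^sub>C x + c *\<^sub>C y"
    and scaleC_add_left: "(c + d) *\<^sub>C x = c *\<^sub>C x + d *\<^sub>C x"
    and scaleC_scaleC: "c *\<^sub>C (d *\<^sub>C x) = (c * d) *\<^sub>C x"
    and scaleC_of_real: "complex_of_real r *\<^sub>C x = r *\<^sub>R x"
    and cinner_commute: "cinner x y = cnj (cinner y x)"
    and cinner_add_left: "cinner (x + y) z = cinner x z + cinner y z"
    and cinner_scaleC_left: "cinner (c *\<^sub>C x) y = c * cinner x y"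
    and inner_eq_Re_cinner: "inner x y = Re (cinner x y)"

definition bounded_ops :: "('a::chilbert_space \<Rightarrow> 'a) set" where
  "bounded_ops = {T. bounded_linear T \<and> (\<forall>c x. T (c *\<^sub>C x) = c *\<^sub>C T x)}"

definition cadjoint :: "('a::chilbert_space \<Rightarrow> 'a) \<Rightarrow> 'a \<Rightarrow> 'a" where
  "cadjoint T = (THE S. S \<in> bounded_ops \<and> (\<forall>x y. cinner (T x) y = cinner x (S y)))"

definition positive_op :: "('a::chilbert_space \<Rightarrow> 'a) \<Rightarrow> bool" where
  "positive_op A \<longleftrightarrow> A \<in> bounded_ops \<and> (\<forall>x. cinner (A x) x \<in> \<real>\<^sub>\<ge>\<^sub>0)"

definition A_norm :: "('a::chilbert_space \<Rightarrow> 'a) \<Rightarrow> 'a \<Rightarrow> real" where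
  "A_norm A x = sqrt (Re (cinner (A x) x))"

text \<open>
  \<open>A_adjointable_ops A\<close> and \<open>A_bounded_ops A\<close> are the algebras usually written
  \<open>B\<^sub>A(H)\<close> and \<open>B\<close> with subscript \<open>A\<close> to the power \<open>1/2\<close>, respectively.
\<close>

definition A_adjointable_ops :: "('a::chilbert_space \<Rightarrow> 'a) \<Rightarrow> ('a \<Rightarrow> 'a) set" where
  "A_adjointable_ops A = {T \<in> bounded_ops. range (cadjoint T \<circ> A) \<subseteq> range A}"

definition A_bounded_ops :: "('a::chilbert_space \<Rightarrow> 'a) \<Rightarrow> ('a \<Rightarrow> 'a) set" where
  "A_bounded_ops A = {T \<in> bounded_ops. \<exists>c>0. \<forall>x. A_norm A (T x) \<le> c * A_norm A x}"

text \<open>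
  For positive \<open>A\<close> and \<open>T \<in> A_adjointable_ops A\<close> the operator below exists by Douglas' range inclusion
  theorem, and it is unique since \<open>A\<close> is injective on \<open>closure (range A)\<close>.
\<close>

definition sharp :: "('a::chilbert_space \<Rightarrow> 'a) \<Rightarrow> ('a \<Rightarrow> 'a) \<Rightarrow> 'a \<Rightarrow> 'a" where
  "sharp A T = (THE Y. Y \<in> bounded_ops \<and> A \<circ> Y = cadjoint T \<circ> A \<and> range Y \<subseteq> closure (range A))"

definition A_Re :: "('a::chilbert_space \<Rightarrow> 'a) \<Rightarrow> ('a \<Rightarrow> 'a) \<Rightarrow> 'a \<Rightarrow> 'a" where
  "A_Re A T = (\<lambda>x. (T x + sharp A T x) /\<^sub>R 2)"

text \<open>
  For a seminorm \<open>N\<close> the supremum below is over a bounded set, since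
  \<open>N (A_Re A (cis \<theta> T)) \<le> (N T + N (sharp A T)) / 2\<close>.
\<close>

definition A_numerical_radius ::
    "('a::chilbert_space \<Rightarrow> 'a) \<Rightarrow> (('a \<Rightarrow> 'a) \<Rightarrow> real) \<Rightarrow> ('a \<Rightarrow> 'a) \<Rightarrow> real" where
  "A_numerical_radius A N T = (SUP \<theta>::real. N (A_Re A (\<lambda>x. cis \<theta> *\<^sub>C T x)))"

text \<open>
  A seminorm on a set of operators is a total function of which only the values on that set
  are constrained.
\<close>

definition op_seminorm_on ::
    "('a::chilbert_space \<Rightarrow> 'a) set \<Rightarrow> (('a \<Rightarrow> 'a) \<Rightarrow> real) \<Rightarrow> bool" where
  "op_seminorm_on V N \<longleftrightarrow>
     (\<forall>T\<in>V. 0 \<le> N T) \<and>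
     (\<forall>c. \<forall>T\<in>V. N (\<lambda>x. c *\<^sub>C T x) = cmod c * N T) \<and>
     (\<forall>T\<in>V. \<forall>S\<in>V. N (\<lambda>x. T x + S x) \<le> N T + N S)"

definition A_selfadjoint_invariant ::
    "('a::chilbert_space \<Rightarrow> 'a) \<Rightarrow> (('a \<Rightarrow> 'a) \<Rightarrow> real) \<Rightarrow> bool" where
  "A_selfadjoint_invariant A N \<longleftrightarrow> (\<forall>T\<in>A_adjointable_ops A. N T = N (sharp A T))"

definition A_submultiplicative ::
    "('a::chilbert_space \<Rightarrow> 'a) \<Rightarrow> (('a \<Rightarrow> 'a) \<Rightarrow> real) \<Rightarrow> bool" where
  "A_submultiplicative A N \<longleftrightarrow>
     (\<forall>T\<in>A_bounded_ops A. \<forall>S\<in>A_bounded_ops A. N (T \<circ> S) \<le> N T * N S)"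

end

theory Submission
  imports Defs
begin

text \<open>
  Write \<open>T\<^sup>#\<close> for \<open>sharp A T\<close> and \<open>Re\<close> for \<open>A_Re A\<close>.  Put \<open>Z = cis \<theta> (T X S + S\<^sup># X T\<^sup>#)\<close>.  The sharp is
  conjugate linear and reverses products, and \<open>T\<^sup>#\<^sup>#\<^sup># = T\<^sup>#\<close>, so a computation gives
  \<open>Re (Z\<^sup>#) = T\<^sup>#\<^sup># Q S\<^sup>#\<^sup># + S\<^sup># Q T\<^sup>#\<close> with \<open>Q = Re ((cis \<theta> X)\<^sup>#)\<close>
  (\<open>A_Re_sharp_sandwich\<close>).  Since \<open>(Re Z)\<^sup># = Re (Z\<^sup>#)\<close>, invariance of \<open>N\<close> under the sharp shows
  \<open>N (Re Z) = N (Re (Z\<^sup>#))\<close> and \<open>N Q = N (Re (cis \<theta> X))\<close>, the latter being at most the numerical radius of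
  \<open>X\<close>.  The triangle inequality and submultiplicativity then give the bound for the plus sign.  The minus
  sign follows by replacing \<open>T\<close> with \<open>\<i> T\<close>, because rotations do not change the numerical radius.

  The analytic work is in showing that this calculus is available.  First, \<open>sharp A T\<close> is given by a definite
  description, so the operator must be shown to exist; this is Douglas' range inclusion theorem
  (\<open>range_inclusion_factorization\<close>), which rests on orthogonal projections and on the uniform boundedness
  principle.  Second, \<open>N\<close> is controlled only on the operators that are bounded for the seminorm of \<open>A\<close>, and
  every adjointable operator has to be shown to be of this kind (\<open>adjointable_imp_A_bounded\<close>).
\<close>

section \<open>Projections, functionals and weakly bounded sets in a real Hilbert space\<close>

text \<open>
  A minimising sequence for the distance from \<open>x\<close> to \<open>M\<close> is Cauchy by the parallelogram law, and its
  limit is the foot of the perpendicular.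
\<close>

lemma orthogonal_projection_exists:
  fixes M :: "'a::{real_inner,banach} set"
  assumes "subspace M" and "closed M"
  obtains p where "p \<in> M" "\<And>s. s \<in> M \<Longrightarrow> inner (x - p) s = 0"
proof -
  define d where "d = (INF s\<in>M. (norm (x - s))\<^sup>2)"
  have M0: "0 \<in> M"
    using assms(1) by (rule subspace_0)
  have bdd: "bdd_below ((\<lambda>s. (norm (x - s))\<^sup>2) ` M)"
    by (rule bdd_belowI2[of _ 0]) simp
  have d_le: "d \<le> (norm (x - s))\<^sup>2" if "s \<in> M" for s
    unfolding d_def by (rule cINF_lower[OF bdd that])
  have "\<exists>s\<in>M. (norm (x - s))\<^sup>2 < d + 1 / real (Suc n)" for n
  proof -
    have "(INF s\<in>M. (norm (x - s))\<^sup>2) < d + 1 / real (Suc n)"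
      unfolding d_def by simp
    then show ?thesis
      using M0 by (subst (asm) cINF_less_iff[OF _ bdd]) auto
  qed
  then obtain s where sM: "\<And>n. s n \<in> M"
      and s_less: "\<And>n. (norm (x - s n))\<^sup>2 < d + 1 / real (Suc n)"
    by metis
  \<comment> \<open>The midpoint of \<open>s m\<close> and \<open>s n\<close> lies in \<open>M\<close>, hence no closer to \<open>x\<close> than \<open>d\<close> allows; the
    parallelogram law turns this into a Cauchy estimate.\<close>
  have close: "(norm (s m - s n))\<^sup>2 \<le> 2 / real (Suc m) + 2 / real (Suc n)" for m n
  proof -
    have "(1/2) *\<^sub>R (s m + s n) \<in> M"
      using sM assms(1) by (simp add: subspace_add subspace_scale)
    from d_le[OF this] have "d \<le> (norm (x - (1/2) *\<^sub>R (s m + s n)))\<^sup>2" .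
    moreover have "(norm (s m - s n))\<^sup>2 = 2 * (norm (x - s m))\<^sup>2 + 2 * (norm (x - s n))\<^sup>2
        - 4 * (norm (x - (1/2) *\<^sub>R (s m + s n)))\<^sup>2"
      by (simp add: power2_norm_eq_inner inner_simps inner_commute algebra_simps)
    ultimately show ?thesis
      using s_less[of m] s_less[of n] by simp
  qed
  have "Cauchy s"
  proof (rule metric_CauchyI)
    fix e :: real assume "0 < e"
    then obtain k :: nat where k: "4 / e\<^sup>2 < real k"
      using reals_Archimedean2 by blast
    have "dist (s m) (s n) < e" if "k \<le> m" "k \<le> n" for m n
    proof -
      have "4 < e\<^sup>2 * real (Suc k)"
        using k \<open>0 < e\<close> by (simp add: field_simps) (smt (verit) zero_less_power)
      then have "4 / real (Suc k) < e\<^sup>2"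
        by (simp add: field_simps)
      moreover have "2 / real (Suc m) \<le> 2 / real (Suc k)" "2 / real (Suc n) \<le> 2 / real (Suc k)"
        using that by (auto intro!: divide_left_mono)
      ultimately have "(norm (s m - s n))\<^sup>2 < e\<^sup>2"
        using close[of m n] by linarith
      then show ?thesis
        using \<open>0 < e\<close> by (simp add: dist_norm power_less_imp_less_base)
    qed
    then show "\<exists>k. \<forall>m\<ge>k. \<forall>n\<ge>k. dist (s m) (s n) < e"
      by blast
  qed
  then obtain p where p: "s \<longlonglongrightarrow> p"
    using Cauchy_convergent_iff convergent_def by blast
  have pM: "p \<in> M"
    using assms(2) sM p by (rule closed_sequentially)
  have p_le: "(norm (x - p))\<^sup>2 \<le> d"
  proof (rule LIMSEQ_le)
    show "(\<lambda>n. (norm (x - s n))\<^sup>2) \<longlonglongrightarrow> (norm (x - p))\<^sup>2"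
      by (intro tendsto_intros p)
    have "(\<lambda>n. d + 1 / real (Suc n)) \<longlonglongrightarrow> d + 0"
      using LIMSEQ_inverse_real_of_nat by (intro tendsto_intros) (simp add: inverse_eq_divide)
    then show "(\<lambda>n. d + 1 / real (Suc n)) \<longlonglongrightarrow> d"
      by simp
    show "\<exists>N. \<forall>n\<ge>N. (norm (x - s n))\<^sup>2 \<le> d + 1 / real (Suc n)"
      using s_less less_imp_le by blast
  qed
  have "inner (x - p) u = 0" if "u \<in> M" for u
  proof (cases "u = 0")
    case False
    \<comment> \<open>This \<open>t\<close> minimises the distance from \<open>x\<close> to \<open>p + t *\<^sub>R u\<close>; as \<open>p\<close> is already nearest,
      it has to vanish.\<close>
    define t where "t = inner (x - p) u / inner u u"
    have "p + t *\<^sub>R u \<in> M"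
      using pM that assms(1) by (simp add: subspace_add subspace_scale)
    then have "(norm (x - p))\<^sup>2 \<le> (norm (x - (p + t *\<^sub>R u)))\<^sup>2"
      using d_le p_le order_trans by blast
    also have "\<dots> = (norm (x - p))\<^sup>2 - 2 * t * inner (x - p) u + t * (t * inner u u)"
      by (simp add: power2_norm_eq_inner inner_simps inner_commute algebra_simps)
    also have "t * inner u u = inner (x - p) u"
      using False by (simp add: t_def)
    finally have "t * inner (x - p) u \<le> 0"
      by simp
    then have "(inner (x - p) u)\<^sup>2 \<le> 0"
      using False by (simp add: t_def power2_eq_square divide_le_0_iff)
        (metis inner_gt_zero_iff less_le_not_le order_antisym_conv)
    then show ?thesis
      by simp
  qed simp
  with pM that show thesis
    by blast
qed

text \<open>
  The representing vector is a multiple of any nonzero \<open>u\<close> orthogonal to the kernel of \<open>f\<close>, because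
  \<open>x - (f x / f u) *\<^sub>R u\<close> always lies in the kernel.
\<close>

lemma riesz_representation:
  fixes f :: "'a::{real_inner,banach} \<Rightarrow> real"
  assumes "bounded_linear f"
  obtains v where "\<And>x. f x = inner x v"
proof (cases "\<forall>x. f x = 0")
  case True
  then show thesis
    using that[of 0] by simp
next
  case False
  then obtain w where w: "f w \<noteq> 0"
    by blast
  interpret f: bounded_linear f by fact
  have "subspace (f -` {0})"
    by (simp add: subspace_def f.add f.scaleR f.zero)
  moreover have "closed (f -` {0})"
    by (intro continuous_closed_vimage) (auto intro: f.isCont)
  ultimately obtain p where p: "p \<in> f -` {0}" "\<And>s. s \<in> f -` {0} \<Longrightarrow> inner (w - p) s = 0"
    using orthogonal_projection_exists by metis
  define u where "u = w - p"
  have fu: "f u = f w" "f u \<noteq> 0"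
    using p(1) w by (simp_all add: u_def f.diff)
  then have "u \<noteq> 0"
    using f.zero by auto
  have "f x = inner x ((f u / inner u u) *\<^sub>R u)" for x
  proof -
    have "x - (f x / f u) *\<^sub>R u \<in> f -` {0}"
      using fu by (simp add: f.diff f.scaleR)
    then have "inner u (x - (f x / f u) *\<^sub>R u) = 0"
      using p(2) by (simp add: u_def)
    then show ?thesis
      using fu \<open>u \<noteq> 0\<close> by (simp add: inner_diff_right inner_commute field_simps)
  qed
  then show thesis
    by (rule that)
qed

text \<open>
  The uniform boundedness principle for the functionals \<open>inner v\<close>, \<open>v \<in> F\<close>: by Baire's theorem one of
  the closed sets on which they are all bounded by \<open>n\<close> contains a ball, and differences of points of
  that ball reach every direction.
\<close>

lemma weakly_bounded_imp_bounded:
  fixes F :: "'a::{real_inner,banach} set"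
  assumes "\<And>x. \<exists>C. \<forall>v\<in>F. \<bar>inner v x\<bar> \<le> C"
  obtains C where "0 \<le> C" "\<And>v. v \<in> F \<Longrightarrow> norm v \<le> C"
proof -
  define V where "V n = {x. \<forall>v\<in>F. \<bar>inner v x\<bar> \<le> real n}" for n
  have closed_V: "closed (V n)" for n
  proof -
    have "V n = (\<Inter>v\<in>F. {x. \<bar>inner v x\<bar> \<le> real n})"
      by (auto simp: V_def)
    moreover have "closed {x. \<bar>inner v x\<bar> \<le> real n}" for v
      by (intro closed_Collect_le continuous_intros)
    ultimately show ?thesis
      by auto
  qed
  have "x \<in> \<Union>(range V)" for x
  proof -
    obtain C where "\<forall>v\<in>F. \<bar>inner v x\<bar> \<le> C"
      using assms by blast
    moreover obtain n where "C \<le> real n"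
      using real_arch_simple by blast
    ultimately have "x \<in> V n"
      by (force simp: V_def)
    then show ?thesis by blast
  qed
  then have Un: "\<Union>(range V) = UNIV"
    by blast
  have "\<exists>n. interior (V n) \<noteq> {}"
  proof (rule ccontr)
    assume "\<not> ?thesis"
    then have "euclidean interior_of \<Union>(range V) = {}"
      using closed_V completely_metrizable_space_euclidean by (intro Baire_category_alt) auto
    then show False
      using Un by simp
  qed
  then obtain n x0 where "x0 \<in> interior (V n)"
    by blast
  then obtain e where e: "0 < e" "cball x0 e \<subseteq> V n"
    by (meson mem_interior_cball)
  have "norm v \<le> 2 * real n / e" if "v \<in> F" for v
  proof (cases "v = 0")
    case False
    define u where "u = (e / norm v) *\<^sub>R v"
    have "norm u = e"
      using False e by (simp add: u_def)
    then have "x0 + u \<in> V n" "x0 \<in> V n"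
      using e by (auto simp: dist_norm)
    then have "\<bar>inner v (x0 + u)\<bar> \<le> real n" "\<bar>inner v x0\<bar> \<le> real n"
      using that by (auto simp: V_def)
    then have "inner v u \<le> 2 * real n"
      by (simp add: inner_add_right)
    moreover have "inner v u = e * norm v"
      using False by (simp add: u_def dot_square_norm power2_eq_square)
    ultimately show ?thesis
      using e by (simp add: field_simps)
  qed (use e in simp)
  then show thesis
    using e that[of "2 * real n / e"] by simp
qed

section \<open>Complex inner products and adjoints\<close>

text \<open>
  The real inner product determines the complex one, since \<open>Im \<langle>a, b\<rangle> = - Re \<langle>\<i> a, b\<rangle>\<close>.  This is how the
  real results above are transferred to complex adjoints.
\<close>

lemma inner_scaleC_left_imp_cinner_eq:
  fixes a b :: "'a::chilbert_space"
  assumes "\<And>c. inner (c *\<^sub>C a) b = inner (c *\<^sub>C a') b'"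
  shows "cinner a b = cinner a' b'"
  using assms[of 1] assms[of \<i>] by (auto simp: inner_eq_Re_cinner cinner_scaleC_left complex_eq_iff)

lemma cinner_add_right: "cinner z (x + y :: 'a::chilbert_space) = cinner z x + cinner z y"
  by (metis cinner_add_left cinner_commute complex_cnj_add)

lemma cinner_scaleC_right: "cinner x (c *\<^sub>C y :: 'a::chilbert_space) = cnj c * cinner x y"
  by (metis cinner_scaleC_left cinner_commute complex_cnj_mult)

lemma cinner_ext_right:
  fixes u v :: "'a::chilbert_space"
  assumes "\<And>x. cinner x u = cinner x v"
  shows "u = v"
proof -
  have "inner x u = inner x v" for x
    using assms by (simp add: inner_eq_Re_cinner)
  then show ?thesis
    by (metis inner_commute inner_eq_zero_iff inner_diff_right right_minus_eq)
qed

lemma cinner_ext_left: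
  fixes u v :: "'a::chilbert_space"
  assumes "\<And>x. cinner u x = cinner v x"
  shows "u = v"
  by (rule cinner_ext_right) (metis assms cinner_commute)

lemma scaleC_minus_right: "c *\<^sub>C (- x :: 'a::chilbert_space) = - (c *\<^sub>C x)"
proof -
  have neg: "- y = complex_of_real (- 1) *\<^sub>C y" for y :: 'a
    by (simp only: scaleC_of_real) simp
  have "c *\<^sub>C (- x) = (c * complex_of_real (- 1)) *\<^sub>C x"
    by (simp only: neg[of x] scaleC_scaleC)
  also have "\<dots> = - (c *\<^sub>C x)"
    by (simp only: neg[of "c *\<^sub>C x"] scaleC_scaleC mult.commute)
  finally show ?thesis .
qed

lemma scaleC_minus_left: "(- c) *\<^sub>C x = - (c *\<^sub>C x :: 'a::chilbert_space)"
proof -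
  have "(- c) *\<^sub>C x + c *\<^sub>C x = complex_of_real 0 *\<^sub>C x"
    by (simp flip: scaleC_add_left)
  then show ?thesis
    by (simp only: scaleC_of_real scaleR_zero_left add_eq_0_iff2)
qed

lemma norm_scaleC: "norm (c *\<^sub>C x :: 'a::chilbert_space) = cmod c * norm x"
proof -
  have "(norm (c *\<^sub>C x))\<^sup>2 = Re (c * cnj c * cinner x x)"
    by (simp add: power2_norm_eq_inner inner_eq_Re_cinner cinner_scaleC_left cinner_scaleC_right
        algebra_simps)
  also have "\<dots> = (cmod c)\<^sup>2 * Re (cinner x x)"
    unfolding complex_norm_square[symmetric] by simp
  also have "\<dots> = (cmod c * norm x)\<^sup>2"
    by (simp add: power_mult_distrib power2_norm_eq_inner inner_eq_Re_cinner)
  finally show ?thesis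
    by (simp add: power2_eq_iff_nonneg)
qed

lemma bounded_opsI:
  fixes T :: "'a::chilbert_space \<Rightarrow> 'a"
  assumes "\<And>x y. T (x + y) = T x + T y" "\<And>c x. T (c *\<^sub>C x) = c *\<^sub>C T x" "\<And>x. norm (T x) \<le> norm x * K"
  shows "T \<in> bounded_ops"
  using assms unfolding bounded_ops_def
  by (auto intro!: bounded_linear_intro simp: scaleC_of_real[symmetric])

lemma bounded_ops_add_arg: "T \<in> bounded_ops \<Longrightarrow> T (x + y) = T x + T y"
  and bounded_ops_scaleC_arg: "T \<in> bounded_ops \<Longrightarrow> T (c *\<^sub>C x) = c *\<^sub>C T x"
  and bounded_ops_bounded_linear: "T \<in> bounded_ops \<Longrightarrow> bounded_linear T"
  by (auto simp: bounded_ops_def linear_simps)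

lemma bounded_ops_comp: "T \<in> bounded_ops \<Longrightarrow> S \<in> bounded_ops \<Longrightarrow> T \<circ> S \<in> bounded_ops"
  by (auto simp: bounded_ops_def o_def intro: bounded_linear_compose)

lemma bounded_ops_add:
  "T \<in> bounded_ops \<Longrightarrow> S \<in> bounded_ops \<Longrightarrow> (\<lambda>x. T x + S x) \<in> bounded_ops"
  by (auto simp: bounded_ops_def scaleC_add_right intro: bounded_linear_add)

lemma bounded_ops_scaleC: "T \<in> bounded_ops \<Longrightarrow> (\<lambda>x. c *\<^sub>C T x) \<in> bounded_ops"
proof (rule bounded_opsI[where K = "cmod c * onorm T"])
  fix x assume T: "T \<in> bounded_ops"
  have "cmod c * norm (T x) \<le> cmod c * (onorm T * norm x)"
    by (intro mult_left_mono onorm bounded_ops_bounded_linear T) simp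
  then show "norm (c *\<^sub>C T x) \<le> norm x * (cmod c * onorm T)"
    by (simp add: norm_scaleC mult_ac)
qed (simp_all add: bounded_ops_add_arg bounded_ops_scaleC_arg scaleC_add_right scaleC_scaleC mult.commute)

text \<open>
  The definite description defining \<open>cadjoint\<close> is meaningful: Riesz' theorem yields the values of the
  adjoint, and linearity, boundedness and uniqueness follow from nondegeneracy.
\<close>

lemma cadjoint_bounded_ops_and_cinner_cadjoint:
  assumes T: "T \<in> bounded_ops"
  shows "cadjoint T \<in> bounded_ops \<and> (\<forall>x y. cinner (T x) y = cinner x (cadjoint T y))"
proof -
  have "\<exists>v. \<forall>x. inner (T x) y = inner x v" for y
  proof -
    have "bounded_linear (\<lambda>x. inner (T x) y)"
      by (intro bounded_linear_inner_left_comp bounded_ops_bounded_linear T)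
    from riesz_representation[OF this] show ?thesis by metis
  qed
  then obtain S where S: "\<And>x y. inner (T x) y = inner x (S y)"
    by metis
  have cS: "cinner (T x) y = cinner x (S y)" for x y
    by (rule inner_scaleC_left_imp_cinner_eq) (metis S T bounded_ops_scaleC_arg)
  obtain K where K: "0 \<le> K" "\<And>x. norm (T x) \<le> norm x * K"
    using bounded_linear.nonneg_bounded[OF bounded_ops_bounded_linear[OF T]] by blast
  have "S \<in> bounded_ops"
  proof (rule bounded_opsI)
    show "S (x + y) = S x + S y" for x y
      by (rule cinner_ext_right) (simp add: cinner_add_right flip: cS)
    show "S (c *\<^sub>C x) = c *\<^sub>C S x" for c x
      by (rule cinner_ext_right) (simp add: cinner_scaleC_right flip: cS)
    show "norm (S x) \<le> norm x * K" for x
    proof (cases "S x = 0")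
      case False
      have "norm (S x) * norm (S x) = inner (T (S x)) x"
        by (simp add: S dot_square_norm power2_eq_square)
      also have "\<dots> \<le> norm (T (S x)) * norm x"
        by (rule norm_cauchy_schwarz)
      also have "\<dots> \<le> norm (S x) * K * norm x"
        by (rule mult_right_mono) (use K in auto)
      finally show ?thesis
        using False by (simp add: mult.commute mult.left_commute)
    qed (use K in simp)
  qed
  moreover have "S' = S" if "\<forall>x y. cinner (T x) y = cinner x (S' y)" for S'
    by (rule ext, rule cinner_ext_right) (use that cS in metis)
  ultimately show ?thesis
    unfolding cadjoint_def using cS
    by (intro theI[where P = "\<lambda>S. S \<in> bounded_ops \<and> (\<forall>x y. cinner (T x) y = cinner x (S y))"]) auto
qed

lemmas cadjoint_bounded_ops = cadjoint_bounded_ops_and_cinner_cadjoint[THEN conjunct1]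
lemmas cinner_cadjoint = cadjoint_bounded_ops_and_cinner_cadjoint[THEN conjunct2, rule_format]

section \<open>Positive operators and their semi-inner product\<close>

lemma positive_op_bounded_ops: "positive_op A \<Longrightarrow> A \<in> bounded_ops"
  by (simp add: positive_op_def)

text \<open>
  Polarization: the quadratic form is real at \<open>x + y\<close> and at \<open>x + \<i> y\<close>, which fixes the imaginary and
  the real part of \<open>\<langle>A x, y\<rangle>\<close>, respectively.
\<close>

lemma positive_op_selfadjoint:
  assumes "positive_op A"
  shows "cinner (A x) y = cinner x (A y)"
proof -
  have A: "A \<in> bounded_ops" and real: "\<And>x. Im (cinner (A x) x) = 0"
    using assms by (auto simp: positive_op_def complex_nonneg_Reals_iff)
  note lin = bounded_ops_add_arg[OF A] bounded_ops_scaleC_arg[OF A]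
  have "Im (cinner (A x) y) + Im (cinner (A y) x) = 0"
    using real[of "x + y"] real[of x] real[of y] by (simp add: lin cinner_add_left cinner_add_right)
  moreover have "Re (cinner (A y) x) = Re (cinner (A x) y)"
    using real[of "x + \<i> *\<^sub>C y"] real[of x] real[of y]
    by (simp add: lin cinner_add_left cinner_add_right cinner_scaleC_left cinner_scaleC_right)
  ultimately have "cinner (A x) y = cnj (cinner (A y) x)"
    by (simp add: complex_eq_iff)
  then show ?thesis
    by (metis cinner_commute)
qed

lemma positive_op_inner_commute:
  assumes "positive_op A"
  shows "inner (A x) y = inner x (A y)"
  by (simp add: inner_eq_Re_cinner positive_op_selfadjoint[OF assms])

lemma A_norm_eq_inner: "A_norm A x = sqrt (inner (A x) x)"
  by (simp add: A_norm_def inner_eq_Re_cinner)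

lemma positive_op_inner_nonneg: "positive_op A \<Longrightarrow> 0 \<le> inner (A x) x"
  by (auto simp: positive_op_def inner_eq_Re_cinner complex_nonneg_Reals_iff)

lemma A_norm_nonneg: "positive_op A \<Longrightarrow> 0 \<le> A_norm A x"
  by (simp add: A_norm_eq_inner positive_op_inner_nonneg)

lemma A_norm_square: "positive_op A \<Longrightarrow> (A_norm A x)\<^sup>2 = inner (A x) x"
  by (simp add: A_norm_eq_inner positive_op_inner_nonneg)

lemma A_norm_Cauchy_Schwarz:
  assumes pos: "positive_op A"
  shows "inner (A x) y \<le> A_norm A x * A_norm A y"
proof -
  define a b c where "a = inner (A x) x" and "b = inner (A x) y" and "c = inner (A y) y"
  interpret A: bounded_linear A
    by (intro bounded_ops_bounded_linear positive_op_bounded_ops pos)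
  \<comment> \<open>The real quadratic polynomial \<open>t \<mapsto> \<langle>A (x + t y), x + t y\<rangle>\<close> is nonnegative, so its
    discriminant is not positive.  The form may be degenerate, hence the separate case \<open>c = 0\<close>.\<close>
  have quad: "0 \<le> a + 2 * t * b + t\<^sup>2 * c" for t
  proof -
    have "inner (A y) x = b"
      by (metis b_def inner_commute positive_op_inner_commute[OF pos])
    then have "inner (A (x + t *\<^sub>R y)) (x + t *\<^sub>R y) = a + 2 * t * b + t\<^sup>2 * c"
      by (simp add: A.add A.scaleR inner_add_left inner_add_right a_def b_def c_def
          power2_eq_square algebra_simps)
    then show ?thesis
      using positive_op_inner_nonneg[OF pos] by metis
  qed
  have "b\<^sup>2 \<le> a * c"
  proof (cases "c = 0")
    case True
    have "b = 0"
    proof (rule ccontr)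
      assume "b \<noteq> 0"
      with quad[of "- (a + 1) / (2 * b)"] True show False
        by (simp add: field_simps)
    qed
    then show ?thesis
      using True by simp
  next
    case False
    then have "0 < c"
      using positive_op_inner_nonneg[OF pos, of y] by (simp add: c_def)
    with quad[of "- b / c"] show ?thesis
      by (simp add: field_simps power2_eq_square)
  qed
  then have "b \<le> sqrt (a * c)"
    by (rule real_le_rsqrt)
  then show ?thesis
    by (simp add: A_norm_eq_inner real_sqrt_mult a_def b_def c_def)
qed

section \<open>Adjoints with respect to the semi-inner product\<close>

text \<open>
  This is the defining equation of \<open>sharp A T\<close> without the condition on the range of \<open>Y\<close>.  It involves
  no \<open>cadjoint\<close>, and it is visibly compatible with sums, scalar multiples and products.
\<close>

definition is_A_adjoint :: "('a::chilbert_space \<Rightarrow> 'a) \<Rightarrow> ('a \<Rightarrow> 'a) \<Rightarrow> ('a \<Rightarrow> 'a) \<Rightarrow> bool" where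
  "is_A_adjoint A T Y \<longleftrightarrow>
     Y \<in> bounded_ops \<and> (\<forall>x z. cinner (A (Y x)) z = cinner (A x) (T z))"

lemma is_A_adjoint_iff_cadjoint:
  assumes "T \<in> bounded_ops"
  shows "is_A_adjoint A T Y \<longleftrightarrow> Y \<in> bounded_ops \<and> A \<circ> Y = cadjoint T \<circ> A"
proof -
  have "cinner (A x) (T z) = cinner (cadjoint T (A x)) z" for x z
    by (metis assms cinner_cadjoint cinner_commute)
  then show ?thesis
    unfolding is_A_adjoint_def fun_eq_iff o_def by (metis cinner_ext_left)
qed

lemma is_A_adjoint_imp_adjointable:
  assumes "T \<in> bounded_ops" "is_A_adjoint A T Y"
  shows "T \<in> A_adjointable_ops A"
proof -
  have "cadjoint T \<circ> A = A \<circ> Y"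
    using assms is_A_adjoint_iff_cadjoint by metis
  moreover have "range (A \<circ> Y) \<subseteq> range A"
    by auto
  ultimately show ?thesis
    using assms(1) unfolding A_adjointable_ops_def mem_Collect_eq by metis
qed

text \<open>
  In particular \<open>sharp A T\<close> is again adjointable, with \<open>T\<close> as one of its adjoints.
\<close>

lemma is_A_adjoint_sym:
  assumes "positive_op A" "T \<in> bounded_ops" "is_A_adjoint A T Y"
  shows "is_A_adjoint A Y T"
proof -
  have "cinner (A (T x)) z = cinner (A x) (Y z)" for x z
  proof -
    have "cinner (A (T x)) z = cnj (cinner (A z) (T x))"
      by (metis cinner_commute positive_op_selfadjoint[OF assms(1)])
    also have "\<dots> = cnj (cinner (A (Y z)) x)"
      using assms(3) by (simp add: is_A_adjoint_def)
    also have "\<dots> = cinner (A x) (Y z)"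
      by (metis cinner_commute positive_op_selfadjoint[OF assms(1)])
    finally show ?thesis .
  qed
  then show ?thesis
    using assms(2) by (simp add: is_A_adjoint_def)
qed

lemma is_A_adjoint_add:
  assumes "A \<in> bounded_ops" "is_A_adjoint A T Y" "is_A_adjoint A S Z"
  shows "is_A_adjoint A (\<lambda>x. T x + S x) (\<lambda>x. Y x + Z x)"
  using assms unfolding is_A_adjoint_def
  by (auto simp: bounded_ops_add bounded_ops_add_arg cinner_add_left cinner_add_right)

lemma is_A_adjoint_scaleC:
  assumes "A \<in> bounded_ops" "is_A_adjoint A T Y"
  shows "is_A_adjoint A (\<lambda>x. c *\<^sub>C T x) (\<lambda>x. cnj c *\<^sub>C Y x)"
  using assms unfolding is_A_adjoint_def
  by (auto simp: bounded_ops_scaleC bounded_ops_scaleC_arg cinner_scaleC_left cinner_scaleC_right)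

lemma is_A_adjoint_comp:
  assumes "is_A_adjoint A T Y" "is_A_adjoint A S Z"
  shows "is_A_adjoint A (T \<circ> S) (Z \<circ> Y)"
  using assms unfolding is_A_adjoint_def by (auto simp: bounded_ops_comp)

lemma subspace_range_bounded_op: "A \<in> bounded_ops \<Longrightarrow> subspace (range A)"
  by (intro linear_subspace_image subspace_UNIV bounded_linear.linear bounded_ops_bounded_linear)

lemma subspace_closure:
  fixes M :: "'a::real_normed_vector set"
  assumes "subspace M"
  shows "subspace (closure M)"
  unfolding subspace_def
proof (intro conjI ballI allI)
  show "0 \<in> closure M"
    using subspace_0[OF assms] closure_subset by blast
  show "x + y \<in> closure M" if xy: "x \<in> closure M" "y \<in> closure M" for x y
  proof -
    obtain f g where fg: "\<And>n. f n \<in> M" "f \<longlonglongrightarrow> x" "\<And>n. g n \<in> M" "g \<longlonglongrightarrow> y"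
      using xy by (auto simp: closure_sequential)
    then have "(\<lambda>n. f n + g n) \<longlonglongrightarrow> x + y" "\<And>n. f n + g n \<in> M"
      by (auto intro: tendsto_add subspace_add[OF assms])
    then show ?thesis
      unfolding closure_sequential by (intro exI conjI allI)
  qed
  show "c *\<^sub>R x \<in> closure M" if x: "x \<in> closure M" for c x
  proof -
    obtain f where f: "\<And>n. f n \<in> M" "f \<longlonglongrightarrow> x"
      using x by (auto simp: closure_sequential)
    then have "(\<lambda>n. c *\<^sub>R f n) \<longlonglongrightarrow> c *\<^sub>R x" "\<And>n. c *\<^sub>R f n \<in> M"
      by (auto intro: tendsto_scaleR subspace_scale[OF assms])
    then show ?thesis
      unfolding closure_sequential by (intro exI conjI allI)
  qed
qed

lemma subspace_closure_range: "A \<in> bounded_ops \<Longrightarrow> subspace (closure (range A))"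
  by (intro subspace_closure subspace_range_bounded_op)

lemma closure_range_scaleC:
  assumes A: "A \<in> bounded_ops" and "y \<in> closure (range A)"
  shows "c *\<^sub>C y \<in> closure (range A)"
proof -
  have bl: "bounded_linear (\<lambda>x. c *\<^sub>C x :: 'a)"
    by (rule bounded_ops_bounded_linear, rule bounded_ops_scaleC)
      (simp add: bounded_ops_def bounded_linear_ident)
  have "(\<lambda>x. c *\<^sub>C x) ` closure (range A) \<subseteq> closure (range A)"
  proof (rule image_closure_subset)
    show "continuous_on (closure (range A)) (\<lambda>x. c *\<^sub>C x)"
      by (rule bounded_linear.continuous_on[OF bl continuous_on_id])
    have "c *\<^sub>C A x \<in> range A" for x
      by (metis A bounded_ops_scaleC_arg rangeI)
    then show "(\<lambda>x. c *\<^sub>C x) ` range A \<subseteq> closure (range A)"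
      using closure_subset by blast
  qed simp
  then show ?thesis
    using assms(2) by blast
qed

text \<open>
  The kernel of \<open>A\<close> is orthogonal to its range, hence also to the closure of the range.
\<close>

lemma positive_op_inj_on_closure_range:
  assumes pos: "positive_op A"
    and u: "u \<in> closure (range A)" and v: "v \<in> closure (range A)" and "A u = A v"
  shows "u = v"
proof -
  have A: "A \<in> bounded_ops"
    using pos by (rule positive_op_bounded_ops)
  have "closure (range A) \<subseteq> {w. inner (u - v) w = 0}"
  proof (rule closure_minimal)
    show "closed {w. inner (u - v) w = 0}"
      by (intro closed_Collect_eq continuous_intros)
    have "inner (u - v) (A x) = inner (A u - A v) x" for x
      by (simp add: inner_diff_left positive_op_inner_commute[OF pos])
    then show "range A \<subseteq> {w. inner (u - v) w = 0}"
      using \<open>A u = A v\<close> by auto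
  qed
  moreover have "u - v \<in> closure (range A)"
    using subspace_closure_range[OF A] u v by (rule subspace_diff)
  ultimately have "inner (u - v) (u - v) = 0"
    by blast
  then show ?thesis
    by simp
qed

lemma sharp_eqI:
  assumes "positive_op A" "T \<in> bounded_ops" "is_A_adjoint A T Y" "range Y \<subseteq> closure (range A)"
  shows "sharp A T = Y"
  unfolding sharp_def
proof (rule the_equality)
  show *: "Y \<in> bounded_ops \<and> A \<circ> Y = cadjoint T \<circ> A \<and> range Y \<subseteq> closure (range A)"
    using assms(3,4) unfolding is_A_adjoint_iff_cadjoint[OF assms(2)] by (elim conjE) (intro conjI)
  fix Z assume Z: "Z \<in> bounded_ops \<and> A \<circ> Z = cadjoint T \<circ> A \<and> range Z \<subseteq> closure (range A)"
  have "A \<circ> Z = A \<circ> Y"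
    using * Z by (elim conjE) (rule trans[OF _ sym])
  then have "A (Z x) = A (Y x)" for x
    by (rule comp_eq_dest)
  then have "Z x = Y x" for x
    using assms(1,4) Z by (auto intro!: positive_op_inj_on_closure_range[OF assms(1), of "Z x" "Y x"])
  then show "Z = Y"
    by blast
qed

text \<open>
  Douglas' factorization, for a positive left factor.  The equation \<open>A y = B x\<close> has exactly one solution
  \<open>y\<close> in the closure of the range of \<open>A\<close>: project any solution there, which changes it only by an element of
  the kernel.  Uniqueness makes \<open>Y\<close> linear.  Boundedness comes from the uniform boundedness principle, as
  \<open>\<langle>A z, Y x\<rangle> = \<langle>B\<^sup>* z, x\<rangle>\<close> shows the vectors \<open>B\<^sup>* z\<close> with \<open>norm (A z) \<le> 1\<close> to be weakly bounded.
\<close>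

lemma range_inclusion_factorization:
  fixes A B :: "'a::chilbert_space \<Rightarrow> 'a"
  assumes pos: "positive_op A" and B: "B \<in> bounded_ops" and range: "range B \<subseteq> range A"
  obtains Y where "Y \<in> bounded_ops" "A \<circ> Y = B" "range Y \<subseteq> closure (range A)"
proof -
  have A: "A \<in> bounded_ops"
    using pos by (rule positive_op_bounded_ops)
  interpret A: bounded_linear A
    using A by (rule bounded_ops_bounded_linear)
  note sub = subspace_closure_range[OF A]
  have "\<exists>y\<in>closure (range A). A y = B x" for x
  proof -
    obtain y0 where y0: "A y0 = B x"
      using range by (metis rangeI image_iff subsetD)
    obtain p where p: "p \<in> closure (range A)" "\<And>s. s \<in> closure (range A) \<Longrightarrow> inner (y0 - p) s = 0"
      using orthogonal_projection_exists[OF sub closed_closure] by metis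
    have "inner (y0 - p) (A z) = 0" for z
      using p(2) closure_subset by blast
    then have "inner (A (y0 - p)) (A (y0 - p)) = 0"
      by (simp add: positive_op_inner_commute[OF pos])
    then have "A p = B x"
      using y0 by (simp add: A.diff)
    with p(1) show ?thesis by blast
  qed
  then obtain Y where Y: "\<And>x. Y x \<in> closure (range A)" "\<And>x. A (Y x) = B x"
    by metis
  note inj = positive_op_inj_on_closure_range[OF pos]
  define B' where "B' = cadjoint B"
  have B': "inner (B x) z = inner x (B' z)" for x z
    by (simp add: B'_def inner_eq_Re_cinner cinner_cadjoint[OF B])
  have B'_bl: "bounded_linear B'"
    unfolding B'_def by (intro bounded_ops_bounded_linear cadjoint_bounded_ops B)
  have Y_A: "inner (A z) (Y x) = inner (B' z) x" for x z
    by (metis B' Y(2) inner_commute positive_op_inner_commute[OF pos])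
  have "\<exists>C. \<forall>v\<in>{B' z | z. norm (A z) \<le> 1}. \<bar>inner v x\<bar> \<le> C" for x
  proof (intro exI ballI)
    fix v assume "v \<in> {B' z | z. norm (A z) \<le> 1}"
    then obtain z where z: "v = B' z" "norm (A z) \<le> 1" by blast
    have "\<bar>inner v x\<bar> \<le> norm (A z) * norm (Y x)"
      unfolding z Y_A[symmetric] by (rule Cauchy_Schwarz_ineq2)
    also have "\<dots> \<le> 1 * norm (Y x)"
      using z(2) by (rule mult_right_mono) simp
    finally show "\<bar>inner v x\<bar> \<le> norm (Y x)" by simp
  qed
  then obtain C where C: "0 \<le> C" "\<And>z. norm (A z) \<le> 1 \<Longrightarrow> norm (B' z) \<le> C"
    by (rule weakly_bounded_imp_bounded) blast
  have range_bound: "inner (A z) (Y x) \<le> C * norm (A z) * norm x" for x z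
  proof (cases "A z = 0")
    case False
    define w where "w = (1 / norm (A z)) *\<^sub>R z"
    have w: "A w = (1 / norm (A z)) *\<^sub>R A z"
      by (simp add: w_def A.scaleR)
    then have "norm (A w) \<le> 1"
      using False by simp
    have "inner (A w) (Y x) \<le> norm (B' w) * norm x"
      unfolding Y_A by (rule norm_cauchy_schwarz)
    also have "\<dots> \<le> C * norm x"
      by (intro mult_right_mono C(2)) (use \<open>norm (A w) \<le> 1\<close> in auto)
    finally show ?thesis
      using False by (simp add: w field_simps)
  qed simp
  \<comment> \<open>By continuity the bound extends to the closure, where \<open>Y x\<close> itself may be inserted.\<close>
  have closure_bound: "closure (range A) \<subseteq> {w. inner w (Y x) \<le> C * norm w * norm x}" for x
  proof (rule closure_minimal)
    show "range A \<subseteq> {w. inner w (Y x) \<le> C * norm w * norm x}"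
      using range_bound by blast
    show "closed {w. inner w (Y x) \<le> C * norm w * norm x}"
      by (intro closed_Collect_le continuous_intros)
  qed
  have "Y \<in> bounded_ops"
  proof (rule bounded_opsI)
    show "Y (x + y) = Y x + Y y" for x y
      by (rule inj) (simp_all add: Y subspace_add[OF sub] A.add bounded_ops_add_arg[OF B])
    show "Y (c *\<^sub>C x) = c *\<^sub>C Y x" for c x
      by (rule inj)
        (simp_all add: Y closure_range_scaleC[OF A] bounded_ops_scaleC_arg[OF A] bounded_ops_scaleC_arg[OF B])
    show "norm (Y x) \<le> norm x * C" for x
    proof (cases "Y x = 0")
      case False
      have "Y x \<in> {w. inner w (Y x) \<le> C * norm w * norm x}"
        using closure_bound Y(1) by blast
      then have "norm (Y x) * norm (Y x) \<le> C * norm (Y x) * norm x"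
        by (simp add: dot_square_norm power2_eq_square)
      then show ?thesis
        using False by (simp add: mult_ac)
    qed (use C in simp)
  qed
  moreover have "A \<circ> Y = B"
    using Y(2) by auto
  ultimately show thesis
    using that Y(1) by blast
qed

lemma sharp_works:
  assumes pos: "positive_op A" and T: "T \<in> A_adjointable_ops A"
  shows is_A_adjoint_sharp: "is_A_adjoint A T (sharp A T)"
    and range_sharp: "range (sharp A T) \<subseteq> closure (range A)"
proof -
  have Tb: "T \<in> bounded_ops"
    using T by (simp add: A_adjointable_ops_def)
  obtain Y where Y: "Y \<in> bounded_ops" "A \<circ> Y = cadjoint T \<circ> A" "range Y \<subseteq> closure (range A)"
  proof (rule range_inclusion_factorization[OF pos])
    show "cadjoint T \<circ> A \<in> bounded_ops"
      by (intro bounded_ops_comp cadjoint_bounded_ops Tb positive_op_bounded_ops pos)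
    show "range (cadjoint T \<circ> A) \<subseteq> range A"
      using T by (simp add: A_adjointable_ops_def)
  qed blast
  then have adj: "is_A_adjoint A T Y"
    using is_A_adjoint_iff_cadjoint[OF Tb] by blast
  then have "sharp A T = Y"
    using pos Tb Y(3) by (intro sharp_eqI)
  then show "is_A_adjoint A T (sharp A T)" "range (sharp A T) \<subseteq> closure (range A)"
    using adj Y(3) by auto
qed

section \<open>The algebra of adjointable operators\<close>

lemma adjointable_bounded_ops: "T \<in> A_adjointable_ops A \<Longrightarrow> T \<in> bounded_ops"
  by (simp add: A_adjointable_ops_def)

context
  fixes A :: "'a::chilbert_space \<Rightarrow> 'a"
  assumes pos: "positive_op A"
begin

lemma adjointable_sharp:
  assumes "T \<in> A_adjointable_ops A"
  shows "sharp A T \<in> A_adjointable_ops A"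
proof -
  have "is_A_adjoint A T (sharp A T)"
    by (rule is_A_adjoint_sharp[OF pos assms])
  then show ?thesis
    using is_A_adjoint_sym[OF pos adjointable_bounded_ops[OF assms]]
    by (intro is_A_adjoint_imp_adjointable) (simp_all add: is_A_adjoint_def)
qed

lemma adjointable_add:
  assumes "T \<in> A_adjointable_ops A" "S \<in> A_adjointable_ops A"
  shows "(\<lambda>x. T x + S x) \<in> A_adjointable_ops A"
    and sharp_add: "sharp A (\<lambda>x. T x + S x) = (\<lambda>x. sharp A T x + sharp A S x)"
proof -
  have A: "A \<in> bounded_ops"
    using pos by (rule positive_op_bounded_ops)
  have b: "(\<lambda>x. T x + S x) \<in> bounded_ops"
    using assms by (intro bounded_ops_add adjointable_bounded_ops)
  have adj: "is_A_adjoint A (\<lambda>x. T x + S x) (\<lambda>x. sharp A T x + sharp A S x)"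
    using assms by (intro is_A_adjoint_add A is_A_adjoint_sharp pos)
  show "(\<lambda>x. T x + S x) \<in> A_adjointable_ops A"
    using b adj by (rule is_A_adjoint_imp_adjointable)
  show "sharp A (\<lambda>x. T x + S x) = (\<lambda>x. sharp A T x + sharp A S x)"
    using pos b adj
  proof (rule sharp_eqI)
    show "range (\<lambda>x. sharp A T x + sharp A S x) \<subseteq> closure (range A)"
      using range_sharp[OF pos] assms subspace_add[OF subspace_closure_range[OF A]] by blast
  qed
qed

lemma adjointable_scaleC:
  assumes "T \<in> A_adjointable_ops A"
  shows "(\<lambda>x. c *\<^sub>C T x) \<in> A_adjointable_ops A"
    and sharp_scaleC: "sharp A (\<lambda>x. c *\<^sub>C T x) = (\<lambda>x. cnj c *\<^sub>C sharp A T x)"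
proof -
  have A: "A \<in> bounded_ops"
    using pos by (rule positive_op_bounded_ops)
  have b: "(\<lambda>x. c *\<^sub>C T x) \<in> bounded_ops"
    using assms by (intro bounded_ops_scaleC adjointable_bounded_ops)
  have adj: "is_A_adjoint A (\<lambda>x. c *\<^sub>C T x) (\<lambda>x. cnj c *\<^sub>C sharp A T x)"
    using assms by (intro is_A_adjoint_scaleC A is_A_adjoint_sharp pos)
  show "(\<lambda>x. c *\<^sub>C T x) \<in> A_adjointable_ops A"
    using b adj by (rule is_A_adjoint_imp_adjointable)
  show "sharp A (\<lambda>x. c *\<^sub>C T x) = (\<lambda>x. cnj c *\<^sub>C sharp A T x)"
    using pos b adj
  proof (rule sharp_eqI)
    show "range (\<lambda>x. cnj c *\<^sub>C sharp A T x) \<subseteq> closure (range A)"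
      using range_sharp[OF pos assms] closure_range_scaleC[OF A] by blast
  qed
qed

lemma adjointable_comp:
  assumes "T \<in> A_adjointable_ops A" "S \<in> A_adjointable_ops A"
  shows "T \<circ> S \<in> A_adjointable_ops A"
    and sharp_comp: "sharp A (T \<circ> S) = sharp A S \<circ> sharp A T"
proof -
  have b: "T \<circ> S \<in> bounded_ops"
    using assms by (intro bounded_ops_comp adjointable_bounded_ops)
  have adj: "is_A_adjoint A (T \<circ> S) (sharp A S \<circ> sharp A T)"
    using assms by (intro is_A_adjoint_comp is_A_adjoint_sharp pos)
  show "T \<circ> S \<in> A_adjointable_ops A"
    using b adj by (rule is_A_adjoint_imp_adjointable)
  show "sharp A (T \<circ> S) = sharp A S \<circ> sharp A T"
    using pos b adj
  proof (rule sharp_eqI)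
    show "range (sharp A S \<circ> sharp A T) \<subseteq> closure (range A)"
      using range_sharp[OF pos assms(2)] by auto
  qed
qed

text \<open>
  The second sharp need not be \<open>T\<close>: it agrees with \<open>T\<close> only up to the kernel of \<open>A\<close>.  That is enough for
  both to have the same adjoint.
\<close>

lemma sharp_sharp_sharp:
  assumes T: "T \<in> A_adjointable_ops A"
  shows "sharp A (sharp A (sharp A T)) = sharp A T"
proof (rule sharp_eqI[OF pos])
  let ?T' = "sharp A T" and ?T'' = "sharp A (sharp A T)"
  show "?T'' \<in> bounded_ops"
    by (intro adjointable_bounded_ops[of _ A] adjointable_sharp T)
  show "range ?T' \<subseteq> closure (range A)"
    by (rule range_sharp[OF pos T])
  have T': "is_A_adjoint A T ?T'" and T'': "is_A_adjoint A ?T' ?T''"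
    using T by (auto intro: is_A_adjoint_sharp pos adjointable_sharp)
  have "A (?T'' x) = A (T x)" for x
  proof (rule cinner_ext_left)
    show "cinner (A (?T'' x)) z = cinner (A (T x)) z" for z
      using T'' is_A_adjoint_sym[OF pos adjointable_bounded_ops[OF T] T'] by (simp add: is_A_adjoint_def)
  qed
  then have "cinner (A x) (?T'' z) = cinner (A x) (T z)" for x z
    by (simp add: positive_op_selfadjoint[OF pos])
  then show "is_A_adjoint A ?T'' ?T'"
    using T' by (simp add: is_A_adjoint_def)
qed

text \<open>
  Write \<open>q = A_norm A\<close> and \<open>R = sharp A T \<circ> T\<close>, which is symmetric for the semi-inner product.  Then
  \<open>(q (T x))\<^sup>2 = \<langle>A x, R x\<rangle> \<le> q x * q (R x)\<close>, so it suffices to bound \<open>R\<close>, and for \<open>R\<close> the ordinary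
  operator norm serves as a bound with respect to \<open>q\<close> by iteration.
\<close>

lemma adjointable_imp_A_bounded:
  assumes T: "T \<in> A_adjointable_ops A"
  shows "T \<in> A_bounded_ops A"
proof -
  let ?q = "A_norm A"
  define R where "R = sharp A T \<circ> T"
  have A: "A \<in> bounded_ops" and Tb: "T \<in> bounded_ops" and T'b: "sharp A T \<in> bounded_ops"
    using pos T by (auto intro: positive_op_bounded_ops adjointable_bounded_ops adjointable_sharp)
  interpret R: bounded_linear R
    unfolding R_def by (intro bounded_ops_bounded_linear bounded_ops_comp Tb T'b)
  have adjT: "is_A_adjoint A T (sharp A T)"
    by (rule is_A_adjoint_sharp[OF pos T])
  have R: "inner (A (R x)) z = inner (A (T x)) (T z)" for x z
    using adjT by (simp add: is_A_adjoint_def R_def inner_eq_Re_cinner)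
  have R_sym: "inner (A (R x)) z = inner (A x) (R z)" for x z
    by (metis R inner_commute positive_op_inner_commute[OF pos])
  \<comment> \<open>The sequence \<open>q ((R ^^ n) x)\<close> is log-convex, so it grows at least geometrically with ratio
    \<open>q (R x) / q x\<close>, while it is at most a multiple of \<open>onorm R ^ n\<close>.\<close>
  have log_convex: "(?q (R x))\<^sup>2 \<le> ?q x * ?q (R (R x))" for x
    using A_norm_Cauchy_Schwarz[OF pos, of x "R (R x)"]
    by (simp add: A_norm_square[OF pos] R_sym)
  have q_le: "?q x \<le> sqrt (onorm A) * norm x" for x
  proof -
    have "inner (A x) x \<le> norm (A x) * norm x"
      by (rule norm_cauchy_schwarz)
    also have "\<dots> \<le> onorm A * norm x * norm x"
      by (intro mult_right_mono onorm bounded_ops_bounded_linear A) simp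
    finally have "sqrt (inner (A x) x) \<le> sqrt (onorm A * (norm x * norm x))"
      by (simp add: mult.assoc)
    then show ?thesis
      by (simp add: A_norm_eq_inner real_sqrt_mult)
  qed
  have qR: "?q (R x) \<le> onorm R * ?q x" for x
  proof (rule ccontr)
    assume neg: "\<not> ?thesis"
    have "?q x \<noteq> 0"
    proof
      assume "?q x = 0"
      then have "(?q (R x))\<^sup>2 \<le> 0"
        using log_convex[of x] by simp
      then show False
        using neg \<open>?q x = 0\<close> by simp
    qed
    then have qx: "0 < ?q x"
      using A_norm_nonneg[OF pos] by (simp add: less_le)
    define t where "t = ?q (R x) / ?q x"
    have t: "onorm R < t"
      using neg qx by (simp add: t_def field_simps)
    have onR: "0 \<le> onorm R"
      by (rule onorm_pos_le) (rule R.bounded_linear_axioms)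
    have t0: "0 < t"
      using onR t by simp
    have step: "0 < ?q ((R ^^ n) x) \<and> t * ?q ((R ^^ n) x) \<le> ?q ((R ^^ Suc n) x)" for n
    proof (induction n)
      case 0
      then show ?case
        using qx by (simp add: t_def)
    next
      case (Suc n)
      let ?a = "?q ((R ^^ n) x)" and ?b = "?q ((R ^^ Suc n) x)" and ?c = "?q ((R ^^ Suc (Suc n)) x)"
      have a: "0 < ?a" and b: "t * ?a \<le> ?b"
        using Suc by auto
      then have b0: "0 < ?b"
        using t0 by (smt (verit) mult_pos_pos)
      have "?a * (t * ?b) \<le> ?b * ?b"
        using mult_right_mono[OF b, of ?b] b0 by (simp add: mult_ac)
      also have "\<dots> \<le> ?a * ?c"
        using log_convex[of "(R ^^ n) x"] by (simp add: power2_eq_square)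
      finally show ?case
        using a b0 by simp
    qed
    have lower: "t ^ n * ?q x \<le> ?q ((R ^^ n) x)" for n
    proof (induction n)
      case (Suc n)
      have "t ^ Suc n * ?q x \<le> t * ?q ((R ^^ n) x)"
        using Suc t0 by (simp add: mult.assoc)
      also have "\<dots> \<le> ?q ((R ^^ Suc n) x)"
        using step by blast
      finally show ?case .
    qed simp
    have norm_R: "norm ((R ^^ n) x) \<le> onorm R ^ n * norm x" for n
    proof (induction n)
      case (Suc n)
      have "norm ((R ^^ Suc n) x) \<le> onorm R * norm ((R ^^ n) x)"
        using onorm[OF R.bounded_linear_axioms] by simp
      also have "\<dots> \<le> onorm R * (onorm R ^ n * norm x)"
        using Suc onR by (rule mult_left_mono)
      finally show ?case
        by (simp add: mult.assoc)
    qed simp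
    define K where "K = sqrt (onorm A) * norm x"
    have onA: "0 \<le> onorm A"
      by (intro onorm_pos_le bounded_ops_bounded_linear A)
    have bound: "t ^ n * ?q x \<le> onorm R ^ n * K" for n
    proof -
      have "t ^ n * ?q x \<le> sqrt (onorm A) * norm ((R ^^ n) x)"
        using lower q_le order_trans by blast
      also have "\<dots> \<le> sqrt (onorm A) * (onorm R ^ n * norm x)"
        using norm_R onA by (intro mult_left_mono) auto
      finally show ?thesis
        by (simp add: K_def mult_ac)
    qed
    have "(\<lambda>n. (onorm R / t) ^ n * K) \<longlonglongrightarrow> 0 * K"
      using onR t t0 by (intro tendsto_intros LIMSEQ_power_zero) simp
    moreover have "?q x \<le> (onorm R / t) ^ n * K" for n
      using bound[of n] t0 by (simp add: field_simps power_divide)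
    ultimately have "?q x \<le> 0 * K"
      by (intro LIMSEQ_le_const) auto
    then show False
      using qx by simp
  qed
  have qT: "?q (T x) \<le> sqrt (onorm R) * ?q x" for x
  proof -
    have "(?q (T x))\<^sup>2 = inner (A x) (R x)"
      by (simp add: A_norm_square[OF pos] flip: R R_sym)
    also have "\<dots> \<le> ?q x * ?q (R x)"
      by (rule A_norm_Cauchy_Schwarz[OF pos])
    also have "\<dots> \<le> ?q x * (onorm R * ?q x)"
      by (intro mult_left_mono qR A_norm_nonneg pos)
    finally have "?q (T x) \<le> sqrt (onorm R * (?q x)\<^sup>2)"
      by (intro real_le_rsqrt) (simp add: power2_eq_square mult_ac)
    then show ?thesis
      by (simp add: real_sqrt_mult A_norm_nonneg[OF pos])
  qed
  have "?q (T x) \<le> (sqrt (onorm R) + 1) * ?q x" for x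
    using qT[of x] A_norm_nonneg[OF pos, of x] by (simp add: algebra_simps)
  moreover have "0 < sqrt (onorm R) + 1"
    using onorm_pos_le[OF R.bounded_linear_axioms] by (simp add: add_nonneg_pos)
  ultimately show ?thesis
    using Tb unfolding A_bounded_ops_def by blast
qed

end

section \<open>The numerical radius inequality\<close>

lemma A_Re_eq: "A_Re A T = (\<lambda>x. complex_of_real (1/2) *\<^sub>C (T x + sharp A T x))"
  by (simp only: A_Re_def scaleC_of_real) simp

lemma adjointable_A_Re:
  assumes "positive_op A" "T \<in> A_adjointable_ops A"
  shows "A_Re A T \<in> A_adjointable_ops A"
  unfolding A_Re_eq
  using assms by (intro adjointable_scaleC adjointable_add adjointable_sharp)

lemma sharp_A_Re:
  assumes "positive_op A" "T \<in> A_adjointable_ops A"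
  shows "sharp A (A_Re A T) = A_Re A (sharp A T)"
  unfolding A_Re_eq
  using assms by (simp add: sharp_scaleC sharp_add adjointable_add adjointable_sharp)

text \<open>
  The algebraic core.  The sharp of \<open>Z\<close> is used and not \<open>Z\<close> itself because every factor \<open>T\<close>, \<open>S\<close> then
  carries either one or two sharps, and three sharps reduce to one.  So the terms of the real part group
  into two products with the common middle factor \<open>Q\<close>; for \<open>Z\<close> itself, \<open>T\<close> and \<open>T\<^sup>#\<^sup>#\<close> would not match.
\<close>

lemma A_Re_sharp_sandwich:
  fixes c :: complex
  assumes pos: "positive_op A"
    and T: "T \<in> A_adjointable_ops A" and S: "S \<in> A_adjointable_ops A" and X: "X \<in> A_adjointable_ops A"
  defines "Z \<equiv> (\<lambda>x. c *\<^sub>C ((T \<circ> X \<circ> S) x + (sharp A S \<circ> X \<circ> sharp A T) x))"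
    and "Q \<equiv> A_Re A (sharp A (\<lambda>x. c *\<^sub>C X x))"
  shows "Z \<in> A_adjointable_ops A"
    and "A_Re A (sharp A Z) = (\<lambda>x. (sharp A (sharp A T) \<circ> Q \<circ> sharp A (sharp A S)) x
                                  + (sharp A S \<circ> Q \<circ> sharp A T) x)"
proof -
  note adj = adjointable_add[OF pos] adjointable_scaleC[OF pos] adjointable_comp[OF pos]
    adjointable_sharp[OF pos] T S X
  note sh = sharp_add[OF pos] sharp_scaleC[OF pos] sharp_comp[OF pos] sharp_sharp_sharp[OF pos]
  have TXS: "T \<circ> X \<circ> S \<in> A_adjointable_ops A"
    and SXT: "sharp A S \<circ> X \<circ> sharp A T \<in> A_adjointable_ops A"
    by (intro adj)+
  show "Z \<in> A_adjointable_ops A"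
    unfolding Z_def by (intro adj)
  have shZ: "sharp A Z = (\<lambda>x. cnj c *\<^sub>C
      ((sharp A S \<circ> (sharp A X \<circ> sharp A T)) x
        + (sharp A (sharp A T) \<circ> (sharp A X \<circ> sharp A (sharp A S))) x))"
    unfolding Z_def
    by (simp only: sh adj TXS SXT)
  have shshZ: "sharp A (sharp A Z) = (\<lambda>x. c *\<^sub>C
      ((sharp A (sharp A T) \<circ> sharp A (sharp A X) \<circ> sharp A (sharp A S)) x
        + (sharp A S \<circ> sharp A (sharp A X) \<circ> sharp A T) x))"
    unfolding shZ
    by (simp only: sh adj complex_cnj_cnj)
  have "sharp A S \<in> bounded_ops" "sharp A (sharp A T) \<in> bounded_ops"
    by (intro adjointable_bounded_ops[of _ A] adj)+
  note lin = this[THEN bounded_ops_add_arg] this[THEN bounded_ops_scaleC_arg]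
  show "A_Re A (sharp A Z) = (\<lambda>x. (sharp A (sharp A T) \<circ> Q \<circ> sharp A (sharp A S)) x
                                  + (sharp A S \<circ> Q \<circ> sharp A T) x)"
    unfolding A_Re_eq Q_def shshZ
    unfolding shZ
    by (simp add: sh adj lin fun_eq_iff scaleC_add_right algebra_simps)
qed

context
  fixes A :: "'a::chilbert_space \<Rightarrow> 'a" and N :: "('a \<Rightarrow> 'a) \<Rightarrow> real"
  assumes pos: "positive_op A"
    and semi: "op_seminorm_on (A_bounded_ops A) N"
    and sainv: "A_selfadjoint_invariant A N"
    and submult: "A_submultiplicative A N"
begin

lemma seminorm_nonneg: "T \<in> A_adjointable_ops A \<Longrightarrow> 0 \<le> N T"
  and seminorm_scaleC: "T \<in> A_adjointable_ops A \<Longrightarrow> N (\<lambda>x. c *\<^sub>C T x) = cmod c * N T"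
  and seminorm_triangle: "T \<in> A_adjointable_ops A \<Longrightarrow> S \<in> A_adjointable_ops A
        \<Longrightarrow> N (\<lambda>x. T x + S x) \<le> N T + N S"
  using semi adjointable_imp_A_bounded[OF pos] unfolding op_seminorm_on_def by blast+

lemma seminorm_sharp: "T \<in> A_adjointable_ops A \<Longrightarrow> N (sharp A T) = N T"
  using sainv by (simp add: A_selfadjoint_invariant_def)

lemma seminorm_comp_comp:
  assumes "T \<in> A_adjointable_ops A" "Q \<in> A_adjointable_ops A" "S \<in> A_adjointable_ops A"
  shows "N (T \<circ> Q \<circ> S) \<le> N T * N Q * N S"
proof -
  have sub: "N (U \<circ> V) \<le> N U * N V" if "U \<in> A_adjointable_ops A" "V \<in> A_adjointable_ops A" for U V
    using submult that adjointable_imp_A_bounded[OF pos] by (simp add: A_submultiplicative_def)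
  have "N (T \<circ> Q \<circ> S) \<le> N (T \<circ> Q) * N S"
    by (intro sub adjointable_comp pos assms)
  also have "\<dots> \<le> (N T * N Q) * N S"
    by (intro mult_right_mono sub seminorm_nonneg assms)
  finally show ?thesis .
qed

text \<open>
  The supremum defining the numerical radius is over a set bounded by \<open>N X\<close>, so it is an upper bound.
\<close>

lemma seminorm_A_Re_le_numerical_radius:
  assumes X: "X \<in> A_adjointable_ops A"
  shows "N (A_Re A (\<lambda>x. cis \<theta> *\<^sub>C X x)) \<le> A_numerical_radius A N X"
  unfolding A_numerical_radius_def
proof (rule cSUP_upper)
  have "N (A_Re A (\<lambda>x. cis \<theta> *\<^sub>C X x)) \<le> N X" for \<theta>
  proof -
    let ?Y = "\<lambda>x. cis \<theta> *\<^sub>C X x"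
    have Y: "?Y \<in> A_adjointable_ops A" "sharp A ?Y \<in> A_adjointable_ops A"
      by (intro adjointable_scaleC adjointable_sharp pos X)+
    have "N (A_Re A ?Y) = (1/2) * N (\<lambda>x. ?Y x + sharp A ?Y x)"
      unfolding A_Re_eq by (subst seminorm_scaleC) (use Y in \<open>auto intro: adjointable_add pos\<close>)
    also have "\<dots> \<le> (1/2) * (N ?Y + N (sharp A ?Y))"
      by (intro mult_left_mono seminorm_triangle Y) simp
    also have "\<dots> = N X"
      using X Y by (simp add: seminorm_sharp seminorm_scaleC)
    finally show ?thesis .
  qed
  then show "bdd_above (range (\<lambda>\<theta>. N (A_Re A (\<lambda>x. cis \<theta> *\<^sub>C X x))))"
    by (intro bdd_aboveI2)
qed simp

text \<open>
  The inequality for each rotation angle separately; submultiplicativity and selfadjoint invariance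
  turn the two products of the previous decomposition into the two copies of the right-hand side.
\<close>

lemma seminorm_A_Re_sandwich_le:
  assumes T: "T \<in> A_adjointable_ops A" and S: "S \<in> A_adjointable_ops A" and X: "X \<in> A_adjointable_ops A"
  shows "N (A_Re A (\<lambda>x. cis \<theta> *\<^sub>C ((T \<circ> X \<circ> S) x + (sharp A S \<circ> X \<circ> sharp A T) x)))
           \<le> 2 * N T * N S * A_numerical_radius A N X"
proof -
  define Z where "Z = (\<lambda>x. cis \<theta> *\<^sub>C ((T \<circ> X \<circ> S) x + (sharp A S \<circ> X \<circ> sharp A T) x))"
  define Q where "Q = A_Re A (sharp A (\<lambda>x. cis \<theta> *\<^sub>C X x))"
  note sandwich = A_Re_sharp_sandwich[OF pos T S X, of "cis \<theta>", folded Z_def Q_def]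
  note adj = adjointable_sharp[OF pos] T S X
  have cX: "(\<lambda>x. cis \<theta> *\<^sub>C X x) \<in> A_adjointable_ops A"
    by (intro adjointable_scaleC pos X)
  have Q: "Q \<in> A_adjointable_ops A"
    unfolding Q_def by (intro adjointable_A_Re pos adj cX)
  have NQ: "N Q \<le> A_numerical_radius A N X"
    using seminorm_A_Re_le_numerical_radius[OF X, of \<theta>] seminorm_sharp[OF adjointable_A_Re[OF pos cX]]
    by (simp add: Q_def sharp_A_Re[OF pos cX])
  have "N (A_Re A Z) = N (A_Re A (sharp A Z))"
    using seminorm_sharp[OF adjointable_A_Re[OF pos sandwich(1)]] by (simp add: sharp_A_Re[OF pos sandwich(1)])
  also have "\<dots> \<le> N (sharp A (sharp A T) \<circ> Q \<circ> sharp A (sharp A S)) + N (sharp A S \<circ> Q \<circ> sharp A T)"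
    unfolding sandwich(2) by (intro seminorm_triangle adjointable_comp pos adj Q)
  also have "\<dots> \<le> N T * N Q * N S + N S * N Q * N T"
    using seminorm_comp_comp[of "sharp A (sharp A T)" Q "sharp A (sharp A S)"]
      seminorm_comp_comp[of "sharp A S" Q "sharp A T"]
    by (intro add_mono) (simp_all only: adj Q seminorm_sharp)
  also have "\<dots> = 2 * N T * N S * N Q"
    by simp
  also have "\<dots> \<le> 2 * N T * N S * A_numerical_radius A N X"
    using NQ by (intro mult_left_mono) (simp_all add: seminorm_nonneg T S)
  finally show ?thesis
    by (simp add: Z_def)
qed

end

theorem theorem3p6:
  fixes A T S X :: "'a::chilbert_space \<Rightarrow> 'a"
    and N :: "('a \<Rightarrow> 'a) \<Rightarrow> real"
  assumes "positive_op A" and "A \<noteq> (\<lambda>x. 0)"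
    and "T \<in> A_adjointable_ops A" and "S \<in> A_adjointable_ops A" and "X \<in> A_adjointable_ops A"
    and "op_seminorm_on (A_bounded_ops A) N"
    and "A_selfadjoint_invariant A N"
    and "A_submultiplicative A N"
  shows "A_numerical_radius A N (\<lambda>x. (T \<circ> X \<circ> S) x + (sharp A S \<circ> X \<circ> sharp A T) x)
           \<le> 2 * N T * N S * A_numerical_radius A N X
         \<and> A_numerical_radius A N (\<lambda>x. (T \<circ> X \<circ> S) x - (sharp A S \<circ> X \<circ> sharp A T) x)
           \<le> 2 * N T * N S * A_numerical_radius A N X"
proof
  note pos = assms(1) and T = assms(3) and S = assms(4) and X = assms(5) and norm = assms(6-8)
  note pointwise = seminorm_A_Re_sandwich_le[OF pos norm _ S X]
  show "A_numerical_radius A N (\<lambda>x. (T \<circ> X \<circ> S) x + (sharp A S \<circ> X \<circ> sharp A T) x)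
          \<le> 2 * N T * N S * A_numerical_radius A N X"
    unfolding A_numerical_radius_def[of A N "\<lambda>x. (T \<circ> X \<circ> S) x + _ x"]
    by (intro cSUP_least pointwise[OF T]) simp
  \<comment> \<open>For the minus sign, \<open>T\<close> is replaced by \<open>\<i> T\<close>, whose sharp is \<open>- \<i> T\<^sup>#\<close>.  The sum becomes \<open>\<i>\<close>
    times the difference, and the factor \<open>\<i>\<close> only shifts the angle by \<open>pi / 2\<close>.\<close>
  define T1 where "T1 = (\<lambda>x. \<i> *\<^sub>C T x)"
  have T1: "T1 \<in> A_adjointable_ops A"
    unfolding T1_def by (intro adjointable_scaleC pos T)
  have N_T1: "N T1 = N T"
    by (simp add: T1_def seminorm_scaleC[OF pos norm T])
  have "sharp A S \<in> bounded_ops" "X \<in> bounded_ops"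
    by (intro adjointable_bounded_ops[of _ A] adjointable_sharp[OF pos] S X)+
  note lin = this[THEN bounded_ops_scaleC_arg]
  have rotate: "(\<lambda>x. cis \<theta> *\<^sub>C ((T \<circ> X \<circ> S) x - (sharp A S \<circ> X \<circ> sharp A T) x))
      = (\<lambda>x. cis (\<theta> - pi / 2) *\<^sub>C ((T1 \<circ> X \<circ> S) x + (sharp A S \<circ> X \<circ> sharp A T1) x))" for \<theta>
  proof
    fix x
    let ?u = "T (X (S x))" and ?v = "sharp A S (X (sharp A T x))"
    have "sharp A S (X (sharp A T1 x)) = (- \<i>) *\<^sub>C ?v"
      by (simp add: T1_def sharp_scaleC[OF pos T] lin)
    also have "\<dots> = \<i> *\<^sub>C (- ?v)"
      by (simp add: scaleC_minus_left scaleC_minus_right)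
    finally have "(T1 \<circ> X \<circ> S) x + (sharp A S \<circ> X \<circ> sharp A T1) x = \<i> *\<^sub>C (?u - ?v)"
      using scaleC_add_right[of \<i> ?u "- ?v"] by (simp add: T1_def)
    moreover have "cis (\<theta> - pi / 2) * \<i> = cis \<theta>"
      by (simp add: cis_mult flip: cis_pi_half)
    ultimately show "cis \<theta> *\<^sub>C ((T \<circ> X \<circ> S) x - (sharp A S \<circ> X \<circ> sharp A T) x)
        = cis (\<theta> - pi / 2) *\<^sub>C ((T1 \<circ> X \<circ> S) x + (sharp A S \<circ> X \<circ> sharp A T1) x)"
      by (simp add: scaleC_scaleC)
  qed
  show "A_numerical_radius A N (\<lambda>x. (T \<circ> X \<circ> S) x - (sharp A S \<circ> X \<circ> sharp A T) x)
          \<le> 2 * N T * N S * A_numerical_radius A N X"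
    unfolding A_numerical_radius_def[of A N "\<lambda>x. (T \<circ> X \<circ> S) x - _ x"] rotate
    by (intro cSUP_least pointwise[OF T1, unfolded N_T1]) simp
qed

end
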